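(* Let $\mathcal A$ be the real vector space of all tensors $A^{ijkl}=C^{ijkl}-C^{(ijkl)}$, where $C$ ranges over all elasticity tensors in three dimensions. Then $\dim\mathcal A=6$.
   Context: Indices run over $1,2,3$. An elasticity tensor is a real fourth-rank tensor $C^{ijkl}$ on $\mathbb R^3$ with $C^{ijkl}=C^{jikl}$, $C^{ijkl}=C^{ijlk}$ (minor symmetries) and $C^{ijkl}=C^{klij}$ (major symmetry). $C^{(ijkl)}$ denotes total symmetrization, $\frac1{4!}$ times the sum over all permutations of the four indices. *)

theory Defs
  imports "HOL-Analysis.Analysis" "HOL-Combinatorics.Permutations"
begin

type_synonym tensor4 = "real^3^3^3^3"

definition elasticity_tensors :: "tensor4 set" where
  "elasticity_tensors = {C. \<forall>i j k l.
     C $ i $ j $ k $ l = C $ j $ i $ k $ l \<and>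
     C $ i $ j $ k $ l = C $ i $ j $ l $ k \<and>
     C $ i $ j $ k $ l = C $ k $ l $ i $ j}"

text \<open>The permutations act on the four index positions \<open>0, 1, 2, 3\<close> of \<open>[i, j, k, l]\<close>,
  so coinciding index values are counted with multiplicity.\<close>

definition total_symmetrization :: "tensor4 \<Rightarrow> tensor4" where
  "total_symmetrization C = (\<chi> i j k l. (1 / fact 4) *
     (\<Sum>\<sigma> | \<sigma> permutes {0..<4::nat}.
        C $ ([i, j, k, l] ! \<sigma> 0) $ ([i, j, k, l] ! \<sigma> 1)
          $ ([i, j, k, l] ! \<sigma> 2) $ ([i, j, k, l] ! \<sigma> 3)))"

definition asymmetric_parts :: "tensor4 set" where
  "asymmetric_parts = {C - total_symmetrization C | C. C \<in> elasticity_tensors}"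

lemma linear_total_symmetrization: "linear total_symmetrization"
  by (rule linearI)
    (simp_all add: total_symmetrization_def vec_eq_iff sum.distrib sum_distrib_left
      algebra_simps)

lemma subspace_elasticity_tensors: "subspace elasticity_tensors"
  unfolding subspace_def elasticity_tensors_def by simp

text \<open>The library's \<^const>\<open>dim\<close> of a set is the dimension of its span; since
  \<^const>\<open>asymmetric_parts\<close> is a subspace, it is the dimension of that space itself.\<close>

lemma subspace_asymmetric_parts: "subspace asymmetric_parts"
proof -
  have "asymmetric_parts = (\<lambda>C. C - total_symmetrization C) ` elasticity_tensors"
    by (auto simp: asymmetric_parts_def)
  moreover have "linear (\<lambda>C. C - total_symmetrization C)"
    by (intro linear_compose_sub linear_ident linear_total_symmetrization)
  ultimately show ?thesis
    using linear_subspace_image subspace_elasticity_tensors by metis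
qed

end

theory Submission
  imports Defs
begin

text \<open>On elasticity tensors total symmetrization averages over the three pairings of the index
  positions, so the asymmetric part satisfies a Bianchi identity. In dimension three any four
  indices contain a repetition, and the identity then leaves as independent components only
  \<open>A 2233\<close>, \<open>A 1133\<close>, \<open>A 1122\<close>, \<open>A 1123\<close>, \<open>A 2213\<close>, \<open>A 3312\<close>. All values of
  these six are attained by the elasticity tensors \<open>\<delta> ij M kl + M ij \<delta> kl\<close>
  with \<open>M\<close> symmetric.\<close>

lemma elasticity_tensorsD:
  assumes "C \<in> elasticity_tensors"
  shows "C $ i $ j $ k $ l = C $ j $ i $ k $ l"
    and "C $ i $ j $ k $ l = C $ i $ j $ l $ k"
    and "C $ i $ j $ k $ l = C $ k $ l $ i $ j"
  using assms unfolding elasticity_tensors_def by blast+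

lemma sum_permutes_4:
  "(\<Sum>\<sigma> | \<sigma> permutes {0..<4::nat}. f (\<sigma> 0) (\<sigma> 1) (\<sigma> 2) (\<sigma> 3)) =
    f 0 1 2 3 + f 0 1 3 2 + f 0 2 1 3 + f 0 2 3 1 + f 0 3 1 2 + f 0 3 2 1 +
    f 1 0 2 3 + f 1 0 3 2 + f 1 2 0 3 + f 1 2 3 0 + f 1 3 0 2 + f 1 3 2 0 +
    f 2 0 1 3 + f 2 0 3 1 + f 2 1 0 3 + f 2 1 3 0 + f 2 3 0 1 + f 2 3 1 0 +
    f 3 0 1 2 + f 3 0 2 1 + f 3 1 0 2 + f 3 1 2 0 + f 3 2 0 1 + (f 3 2 1 0 :: real)"
proof -
  have *: "{0..<4::nat} = insert 0 (insert 1 (insert 2 (insert 3 {})))"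
    by auto
  show ?thesis
    unfolding *
    by (simp add: sum_over_permutations_insert Transposition.transpose_def)
qed

text \<open>The minor and major symmetries form a group of order 8 on the positions, so each of the
  three pairings accounts for 8 of the 24 permutations.\<close>

lemma total_symmetrization_elasticity:
  assumes "C \<in> elasticity_tensors"
  shows "total_symmetrization C $ i $ j $ k $ l =
    (C $ i $ j $ k $ l + C $ i $ k $ j $ l + C $ i $ l $ j $ k) / 3"
proof -
  note s = elasticity_tensorsD[OF assms]
  \<comment> \<open>The seven nontrivial symmetries; instantiated at the three pairings, they
    collapse the 24 terms to three.\<close>
  have pairing:
    "C $ b $ a $ c $ d = C $ a $ b $ c $ d" "C $ a $ b $ d $ c = C $ a $ b $ c $ d"
    "C $ b $ a $ d $ c = C $ a $ b $ c $ d" "C $ c $ d $ a $ b = C $ a $ b $ c $ d"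
    "C $ d $ c $ a $ b = C $ a $ b $ c $ d" "C $ c $ d $ b $ a = C $ a $ b $ c $ d"
    "C $ d $ c $ b $ a = C $ a $ b $ c $ d" for a b c d
    using s by metis+
  note rules = pairing[of i j k l] pairing[of i k j l] pairing[of i l j k]
  have nth: "[i, j, k, l] ! 0 = i" "[i, j, k, l] ! 1 = j"
      "[i, j, k, l] ! 2 = k" "[i, j, k, l] ! 3 = l"
    by simp_all
  show ?thesis
    unfolding total_symmetrization_def vec_lambda_beta
      sum_permutes_4[of "\<lambda>p q r s. C $ ([i, j, k, l] ! p) $ ([i, j, k, l] ! q)
        $ ([i, j, k, l] ! r) $ ([i, j, k, l] ! s)"] nth
    using rules by (simp add: fact_numeral)
qed

lemma asymmetric_part_eq:
  assumes "C \<in> elasticity_tensors"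
  shows "(C - total_symmetrization C) $ i $ j $ k $ l =
    (2 * C $ i $ j $ k $ l - C $ i $ k $ j $ l - C $ i $ l $ j $ k) / 3"
  using total_symmetrization_elasticity[OF assms, of i j k l] by simp

text \<open>Each symmetry keeps the pairing \<open>ij|kl\<close> and fixes or swaps the other two,
  which carry equal coefficients.\<close>

lemma asymmetric_parts_subset_elasticity: "asymmetric_parts \<subseteq> elasticity_tensors"
proof
  fix A assume "A \<in> asymmetric_parts"
  then obtain C where A: "A = C - total_symmetrization C" and C: "C \<in> elasticity_tensors"
    unfolding asymmetric_parts_def by auto
  note s = elasticity_tensorsD[OF C]
  have "A $ i $ j $ k $ l = A $ j $ i $ k $ l" for i j k l
    using s(1)[of i j k l] s(3)[of i k j l] s(3)[of i l j k]
      s(2)[of j l i k] s(2)[of j k i l] s(1)[of j l k i] s(1)[of j k l i]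
    unfolding A asymmetric_part_eq[OF C] by simp
  moreover have "A $ i $ j $ k $ l = A $ i $ j $ l $ k" for i j k l
    using s(2)[of i j k l] unfolding A asymmetric_part_eq[OF C] by simp
  moreover have "A $ i $ j $ k $ l = A $ k $ l $ i $ j" for i j k l
    using s(3)[of i j k l] s(1)[of i k j l] s(2)[of k i j l] s(3)[of i l j k]
      s(1)[of j k i l] s(2)[of k j i l]
    unfolding A asymmetric_part_eq[OF C] by simp
  ultimately show "A \<in> elasticity_tensors"
    unfolding elasticity_tensors_def by blast
qed

text \<open>Over the three terms each pairing collects the coefficients 2, -1, -1.\<close>

lemma asymmetric_parts_Bianchi:
  assumes "A \<in> asymmetric_parts"
  shows "A $ i $ j $ k $ l + A $ i $ k $ j $ l + A $ i $ l $ j $ k = 0"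
proof -
  obtain C where A: "A = C - total_symmetrization C" and C: "C \<in> elasticity_tensors"
    using assms unfolding asymmetric_parts_def by auto
  note s = elasticity_tensorsD[OF C]
  show ?thesis
    using s(2)[of i j k l] s(2)[of i k j l] s(2)[of i l j k]
    unfolding A asymmetric_part_eq[OF C] by (simp add: field_simps)
qed

text \<open>For i, j, k distinct, entry i is \<open>A jjkk\<close> in the first vector and
  \<open>A iijk\<close> in the second.\<close>

definition six_components :: "tensor4 \<Rightarrow> (real^3) \<times> (real^3)" where
  "six_components A =
    (vector [A $ 2 $ 2 $ 3 $ 3, A $ 1 $ 1 $ 3 $ 3, A $ 1 $ 1 $ 2 $ 2],
     vector [A $ 1 $ 1 $ 2 $ 3, A $ 2 $ 2 $ 1 $ 3, A $ 3 $ 3 $ 1 $ 2])"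

lemma linear_six_components: "linear six_components"
  by (rule linearI) (simp_all add: six_components_def vec_eq_iff forall_3)

lemma six_components_eq_0D:
  assumes A: "A \<in> asymmetric_parts" and zero: "six_components A = 0"
  shows "A = 0"
proof -
  note s = elasticity_tensorsD[OF subsetD[OF asymmetric_parts_subset_elasticity A]]
  note b = asymmetric_parts_Bianchi[OF A]
  have z: "A $ 2 $ 2 $ 3 $ 3 = 0" "A $ 1 $ 1 $ 3 $ 3 = 0" "A $ 1 $ 1 $ 2 $ 2 = 0"
    "A $ 1 $ 1 $ 2 $ 3 = 0" "A $ 2 $ 2 $ 1 $ 3 = 0" "A $ 3 $ 3 $ 1 $ 2 = 0"
    using zero by (simp_all add: six_components_def zero_prod_def vec_eq_iff forall_3)
  \<comment> \<open>Here major symmetry makes all three Bianchi terms equal.\<close>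
  have iiik: "A $ i $ i $ i $ k = 0" for i k
    using b[of i i i k] s(3)[of i i i k] by linarith
  have iijk: "A $ i $ i $ j $ k = 0" for i j k
  proof -
    have iiki: "A $ i $ i $ k $ i = 0" for i k
      using iiik[of i k] s(2)[of i i k i] by simp
    have "\<forall>i j k. A $ i $ i $ j $ k = 0"
      unfolding forall_3
      using z s(2)[of 1 1 3 2] s(2)[of 2 2 3 1] s(2)[of 3 3 2 1]
        s(3)[of 3 3 2 2] s(3)[of 3 3 1 1] s(3)[of 2 2 1 1]
      by (simp add: iiik iiki)
    then show ?thesis by blast
  qed
  \<comment> \<open>The last two Bianchi terms agree by major symmetry, so
    \<open>2 * A ijik = - A iijk\<close>.\<close>
  have ijik: "A $ i $ j $ i $ k = 0" for i j k
    using b[of i i j k] iijk[of i j k] s(3)[of i k i j] by linarith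
  have "A $ i $ j $ k $ l = 0" for i j k l
  proof -
    \<comment> \<open>Pigeonhole; the symmetries bring any repetition to the form
      \<open>iijk\<close> or \<open>ijik\<close>.\<close>
    have "i = j \<or> k = l \<or> i = k \<or> i = l \<or> j = k \<or> j = l"
      using exhaust_3[of i] exhaust_3[of j] exhaust_3[of k] exhaust_3[of l] by metis
    then show ?thesis
      using iijk ijik s by metis
  qed
  then show ?thesis by (simp add: vec_eq_iff)
qed

lemma six_components_surj: "six_components ` asymmetric_parts = UNIV"
proof -
  have "\<exists>A\<in>asymmetric_parts. six_components A = (u, v)" for u v
  proof -
    text \<open>The diagonal of \<open>M\<close> solves \<open>M jj + M kk = (3/2) * u $ i\<close> for \<open>i, j, k\<close> distinct.\<close>
    define M :: "real^3^3" where "M = (3/2) *\<^sub>R vector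
      [vector [(u$2 + u$3 - u$1) / 2, v$3, v$2],
       vector [v$3, (u$1 + u$3 - u$2) / 2, v$1],
       vector [v$2, v$1, (u$1 + u$2 - u$3) / 2]]"
    have M: "M $ i $ j = M $ j $ i" for i j
    proof -
      have "\<forall>i j. M $ i $ j = M $ j $ i"
        unfolding forall_3 by (simp add: M_def)
      then show ?thesis by blast
    qed
    define \<delta> :: "3 \<Rightarrow> 3 \<Rightarrow> real" where "\<delta> = (\<lambda>i j. if i = j then 1 else 0)"
    define C :: tensor4 where "C = (\<chi> i j k l. \<delta> i j * M $ k $ l + M $ i $ j * \<delta> k l)"
    have C: "C \<in> elasticity_tensors"
      unfolding elasticity_tensors_def C_def \<delta>_def
      using M by (auto simp: algebra_simps)
    \<comment> \<open>In all six components the two re-paired terms of \<open>C\<close> vanish,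
      leaving (2/3)(\<open>M jj + M kk\<close>) and (2/3) \<open>M jk\<close>; hence the factor 3/2
      in \<open>M\<close>.\<close>
    have "six_components (C - total_symmetrization C) = (u, v)"
      unfolding six_components_def asymmetric_part_eq[OF C]
      by (simp add: C_def \<delta>_def M_def vec_eq_iff forall_3 field_simps)
    then show ?thesis
      using C unfolding asymmetric_parts_def by blast
  qed
  then show ?thesis by (metis UNIV_eq_I image_eqI surj_pair)
qed

theorem proposition8: "dim asymmetric_parts = 6"
proof -
  have "inj_on six_components asymmetric_parts"
    using linear_injective_on_subspace_0[OF linear_six_components subspace_asymmetric_parts]
      six_components_eq_0D by blast
  \<comment> \<open>\<open>dim_image_eq\<close> asks for injectivity on the span.\<close>
  moreover have "span asymmetric_parts = asymmetric_parts"
    using subspace_asymmetric_parts by (simp add: span_eq_iff)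
  ultimately have "dim (six_components ` asymmetric_parts) = dim asymmetric_parts"
    using dim_image_eq[OF linear_six_components] by metis
  then show ?thesis
    unfolding six_components_surj by (simp add: dim_UNIV)
qed

end
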